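(* Let $k:[0,\infty)\to\mathbb{R}$ be any one of the four functions $$k_{\nu=1/2}(d)=\exp(-\sqrt{d}),\qquad k_{\nu=3/2}(d)=\left(1+\sqrt{3}\,\sqrt{d}\right)\exp\left(-\sqrt{3}\,\sqrt{d}\right),$$ $$k_{\nu=5/2}(d)=\left(1+\sqrt{5}\,\sqrt{d}+\tfrac{5}{3}d\right)\exp\left(-\sqrt{5}\,\sqrt{d}\right),\qquad k_{SE}(d)=\exp\left(-\tfrac12 d\right).$$ Then $k$ is convex on $[0,\infty)$. Consequently, for every interval $[d^L,d^U]$ with $0\le d^L<d^U$, the convex envelope of $k$ on $[d^L,d^U]$ is $F^{cv}(d)=k(d)$, and the concave envelope of $k$ on $[d^L,d^U]$ is the secant $$F^{cc}(d)=\frac{k(d^U)-k(d^L)}{d^U-d^L}\,d+\frac{d^U k(d^L)-d^L k(d^U)}{d^U-d^L}.$$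
   Context: The convex envelope of a function $k$ on an interval is the pointwise largest convex function on the interval that is $\le k$ there; the concave envelope is the pointwise smallest concave function on the interval that is $\ge k$ there. The functions are the (unit output variance) Mat\'ern covariance functions with smoothness $\nu=1/2,3/2,5/2,\infty$, written as univariate functions of the squared weighted distance $d\ge 0$. *)

theory Defs
  imports "HOL-Analysis.Convex"
begin

text \<open>
  Functions on a set \<open>S\<close> of reals are represented by total functions of which only the values
  on \<open>S\<close> matter; an envelope is thus determined on \<open>S\<close> only, and there uniquely.
\<close>

definition is_convex_envelope :: "real set \<Rightarrow> (real \<Rightarrow> real) \<Rightarrow> (real \<Rightarrow> real) \<Rightarrow> bool" where
  "is_convex_envelope S k F \<longleftrightarrow>
     convex_on S F \<and> (\<forall>x\<in>S. F x \<le> k x) \<and>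
     (\<forall>G. convex_on S G \<and> (\<forall>x\<in>S. G x \<le> k x) \<longrightarrow> (\<forall>x\<in>S. G x \<le> F x))"

definition is_concave_envelope :: "real set \<Rightarrow> (real \<Rightarrow> real) \<Rightarrow> (real \<Rightarrow> real) \<Rightarrow> bool" where
  "is_concave_envelope S k F \<longleftrightarrow>
     concave_on S F \<and> (\<forall>x\<in>S. k x \<le> F x) \<and>
     (\<forall>G. concave_on S G \<and> (\<forall>x\<in>S. k x \<le> G x) \<longrightarrow> (\<forall>x\<in>S. F x \<le> G x))"

text \<open>
  Matern covariance functions with unit output variance, as functions of the squared weighted
  distance \<open>d \<ge> 0\<close>; the squared exponential is the case of smoothness \<open>\<infinity>\<close>.
\<close>

definition matern_1_2 :: "real \<Rightarrow> real" where
  "matern_1_2 d = exp (- sqrt d)"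

definition matern_3_2 :: "real \<Rightarrow> real" where
  "matern_3_2 d = (1 + sqrt 3 * sqrt d) * exp (- (sqrt 3 * sqrt d))"

definition matern_5_2 :: "real \<Rightarrow> real" where
  "matern_5_2 d = (1 + sqrt 5 * sqrt d + 5 / 3 * d) * exp (- (sqrt 5 * sqrt d))"

definition squared_exponential :: "real \<Rightarrow> real" where
  "squared_exponential d = exp (- (1 / 2 * d))"

end

theory Submission
  imports Defs
begin

text \<open>
  Each kernel is continuous on \<open>[0, \<infinity>)\<close> and has a nondecreasing derivative on \<open>(0, \<infinity>)\<close>, so by
  the mean value theorem its graph lies above the tangent at every point of \<open>(0, \<infinity>)\<close>, which
  gives convexity on \<open>[0, \<infinity>)\<close>; no derivative at \<open>0\<close> is needed, where that of
  \<open>matern_1_2\<close> is infinite. The secant of a convex function on an interval lies above it,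
  and below every concave majorant.
\<close>

lemma convex_on_atLeastI:
  fixes f :: "real \<Rightarrow> real"
  assumes cont: "continuous_on {a..} f"
    and deriv: "\<And>x. a < x \<Longrightarrow> (f has_real_derivative f' x) (at x)"
    and mono: "\<And>x y. a < x \<Longrightarrow> x \<le> y \<Longrightarrow> f' x \<le> f' y"
  shows "convex_on {a..} f"
proof -
  \<comment> \<open>The point of tangency \<open>y\<close> is interior, but \<open>x\<close> may be
    the endpoint \<open>a\<close>, where no derivative is assumed.\<close>
  have tangent: "f y + f' y * (x - y) \<le> f x" if "a < y" "a \<le> x" for x y
  proof (cases x y rule: linorder_cases)
    case less
    \<comment> \<open>Since \<open>x = a\<close> is possible here, the mean value theorem is applied
      in the form that asks for continuity on the closed interval and differentiability only
      inside.\<close>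
    have "continuous_on {x..y} f"
      using cont by (rule continuous_on_subset) (use that in auto)
    moreover have "f differentiable (at u)" if "x < u" for u
      using deriv[of u] that \<open>a \<le> x\<close> by (auto simp: real_differentiable_def)
    ultimately obtain l z where "x < z" "z < y" "(f has_real_derivative l) (at z)"
      "f y - f x = (y - x) * l"
      using MVT[OF less] by blast
    then have z: "x < z" "z < y" "f y - f x = (y - x) * f' z"
      using deriv[of z] that by (auto dest: DERIV_unique)
    then have "(y - x) * f' z \<le> (y - x) * f' y"
      using that less mono[of z y] by (intro mult_left_mono) auto
    with z show ?thesis by (simp add: algebra_simps)
  next
    case greater
    have "\<exists>z. y < z \<and> z < x \<and> f x - f y = (x - y) * f' z"
      using greater that by (intro MVT2 deriv) auto
    then obtain z where z: "y < z" "z < x" "f x - f y = (x - y) * f' z" by blast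
    then have "(x - y) * f' y \<le> (x - y) * f' z"
      using that greater mono[of y z] by (intro mult_left_mono) auto
    with z show ?thesis by (simp add: algebra_simps)
  qed simp
  show ?thesis
  proof (rule convex_onI)
    fix t x y :: real
    assume t: "0 < t" "t < 1" and x: "x \<in> {a..}" and y: "y \<in> {a..}"
    define z where "z = (1 - t) * x + t * y"
    have eq: "z - a = (1 - t) * (x - a) + t * (y - a)"
      by (simp add: z_def algebra_simps)
    \<comment> \<open>Unless both points equal \<open>a\<close>, the weights being positive puts
      \<open>z\<close> strictly to the right of \<open>a\<close>, so the tangent at \<open>z\<close>
      is available. Averaging its bounds at \<open>x\<close> and \<open>y\<close> cancels the slope
      term, because \<open>z\<close> is the same average of \<open>x\<close> and
      \<open>y\<close>.\<close>
    have "f z \<le> (1 - t) * f x + t * f y"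
    proof (cases "x = a \<and> y = a")
      case True
      then show ?thesis using eq by (simp add: algebra_simps)
    next
      case False
      then have "0 < (1 - t) * (x - a) + t * (y - a)"
        using t x y by (cases "x = a") (auto intro: add_pos_nonneg)
      then have "a < z" using eq by simp
      then have "(1 - t) * (f z + f' z * (x - z)) + t * (f z + f' z * (y - z))
          \<le> (1 - t) * f x + t * f y"
        using t x y by (intro add_mono mult_left_mono tangent) auto
      moreover have "(1 - t) * (f z + f' z * (x - z)) + t * (f z + f' z * (y - z))
          = f z + f' z * ((1 - t) * x + t * y - z)"
        by (simp add: algebra_simps)
      ultimately show ?thesis by (simp add: z_def)
    qed
    then show "f ((1 - t) *\<^sub>R x + t *\<^sub>R y) \<le> (1 - t) * f x + t * f y"
      by (simp add: z_def)
  qed simp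
qed

lemma is_convex_envelope_self:
  "convex_on S k \<Longrightarrow> is_convex_envelope S k k"
  by (simp add: is_convex_envelope_def)

lemma concave_on_affine:
  fixes m c :: real
  assumes "convex S"
  shows "concave_on S (\<lambda>x. m * x + c)"
proof -
  have "u * (m * x + c) + v * (m * y + c) = m * (u * x + v * y) + c"
    if "u + v = 1" for u v x y
  proof -
    have "u * (m * x + c) + v * (m * y + c) = m * (u * x + v * y) + (u + v) * c"
      by (simp add: algebra_simps)
    then show ?thesis using that by simp
  qed
  then show ?thesis
    using assms unfolding concave_on_iff by auto
qed

lemma is_concave_envelope_secant:
  assumes conv: "convex_on {a..b} k" and "a < b"
  shows "is_concave_envelope {a..b} k
    (\<lambda>x. (k b - k a) / (b - a) * x + (b * k a - a * k b) / (b - a))"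
proof -
  let ?F = "\<lambda>x. (k b - k a) / (b - a) * x + (b * k a - a * k b) / (b - a)"
  \<comment> \<open>The weight \<open>t = (x - a) / (b - a)\<close> turns the secant value into a
    convex combination of \<open>k a\<close> and \<open>k b\<close>, the form in which convexity of
    \<open>k\<close> and concavity of a majorant \<open>G\<close> apply.\<close>
  have secant: "\<exists>t\<in>{0..1}. x = (1 - t) *\<^sub>R a + t *\<^sub>R b \<and> ?F x = (1 - t) * k a + t * k b"
    if "x \<in> {a..b}" for x
  proof (intro bexI[of _ "(x - a) / (b - a)"] conjI)
    show "x = (1 - (x - a) / (b - a)) *\<^sub>R a + ((x - a) / (b - a)) *\<^sub>R b"
      using \<open>a < b\<close> by (simp add: divide_simps) (simp add: algebra_simps)
    show "?F x = (1 - (x - a) / (b - a)) * k a + (x - a) / (b - a) * k b"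
      using \<open>a < b\<close> by (simp add: divide_simps) (simp add: algebra_simps)
  qed (use that \<open>a < b\<close> in \<open>auto simp: divide_simps\<close>)
  show ?thesis
    unfolding is_concave_envelope_def
  proof (intro conjI ballI allI impI)
    show "concave_on {a..b} ?F"
      by (intro concave_on_affine) simp
  next
    fix x assume "x \<in> {a..b}"
    from secant[OF this] obtain t where "t \<in> {0..1}" "x = (1 - t) *\<^sub>R a + t *\<^sub>R b"
      and F: "?F x = (1 - t) * k a + t * k b" by blast
    then show "k x \<le> ?F x"
      unfolding F using convex_onD[OF conv, of t a b] \<open>a < b\<close> by simp
  next
    fix G x assume G: "concave_on {a..b} G \<and> (\<forall>x\<in>{a..b}. k x \<le> G x)" and "x \<in> {a..b}"
    from secant[OF this(2)] obtain t where t: "t \<in> {0..1}" "x = (1 - t) *\<^sub>R a + t *\<^sub>R b"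
      and F: "?F x = (1 - t) * k a + t * k b" by blast
    have "(1 - t) * k a + t * k b \<le> (1 - t) * G a + t * G b"
      using G t \<open>a < b\<close> by (intro add_mono mult_left_mono) auto
    also have "\<dots> \<le> G x"
      using G t \<open>a < b\<close> concave_onD[of "{a..b}" G t a b] by simp
    finally show "?F x \<le> G x" unfolding F .
  qed
qed

lemma convex_on_matern_1_2: "convex_on {0..} matern_1_2"
proof (rule convex_on_atLeastI)
  show "continuous_on {0..} matern_1_2"
    unfolding matern_1_2_def by (intro continuous_intros)
  show "(matern_1_2 has_real_derivative - (exp (- sqrt x) / (2 * sqrt x))) (at x)"
    if "0 < x" for x
    unfolding matern_1_2_def
    using that by (auto intro!: derivative_eq_intros simp: field_simps)
  show "- (exp (- sqrt x) / (2 * sqrt x)) \<le> - (exp (- sqrt y) / (2 * sqrt y))"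
    if "0 < x" "x \<le> y" for x y
    using that by (auto intro!: frac_le)
qed

lemma convex_on_matern_3_2: "convex_on {0..} matern_3_2"
proof (rule convex_on_atLeastI)
  show "continuous_on {0..} matern_3_2"
    unfolding matern_3_2_def by (intro continuous_intros)
  \<comment> \<open>With \<open>s = sqrt 3 * sqrt x\<close>, the derivative of
    \<open>(1 + s) * exp (- s)\<close> in \<open>s\<close> is \<open>- s * exp (- s)\<close>, and
    the factor \<open>s\<close> cancels against \<open>3 / (2 * s)\<close>, the derivative of
    \<open>s\<close> in \<open>x\<close>.\<close>
  show "(matern_3_2 has_real_derivative - (3 / 2 * exp (- (sqrt 3 * sqrt x)))) (at x)"
    if "0 < x" for x
    unfolding matern_3_2_def
    using that by (auto intro!: derivative_eq_intros simp: field_simps)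
  show "- (3 / 2 * exp (- (sqrt 3 * sqrt x))) \<le> - (3 / 2 * exp (- (sqrt 3 * sqrt y)))"
    if "0 < x" "x \<le> y" for x y
    using that by simp
qed

text \<open>The product \<open>(1 + r) * (1 + (s - r))\<close> exceeds \<open>1 + s\<close> by
  \<open>r * (s - r)\<close>, which is nonnegative, and \<open>1 + u \<le> exp u\<close> bounds its
  second factor. This gives the monotonicity of the derivative of \<open>matern_5_2\<close>.\<close>

lemma one_plus_times_exp_minus_antimono:
  fixes r s :: real
  assumes "0 \<le> r" "r \<le> s"
  shows "(1 + s) * exp (- s) \<le> (1 + r) * exp (- r)"
proof -
  have "1 + s \<le> (1 + r) * (1 + (s - r))"
    using mult_nonneg_nonneg[of r "s - r"] assms by (simp add: algebra_simps)
  also have "\<dots> \<le> (1 + r) * exp (s - r)"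
    using assms by (intro mult_left_mono exp_ge_add_one_self) auto
  finally have "(1 + s) * exp (- s) \<le> (1 + r) * exp (s - r) * exp (- s)"
    by (intro mult_right_mono) auto
  then show ?thesis by (simp add: mult.assoc flip: exp_add)
qed

lemma convex_on_matern_5_2: "convex_on {0..} matern_5_2"
proof (rule convex_on_atLeastI)
  \<comment> \<open>With \<open>s = sqrt 5 * sqrt x\<close> the kernel is
    \<open>(1 + s + s^2 / 3) * exp (- s)\<close>. Its derivative in \<open>s\<close> is
    \<open>- (s / 3) * (1 + s) * exp (- s)\<close>, and that of \<open>s\<close> in \<open>x\<close>
    is \<open>5 / (2 * s)\<close>.\<close>
  let ?D = "\<lambda>x. - (5 / 6 * ((1 + sqrt 5 * sqrt x) * exp (- (sqrt 5 * sqrt x))))"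
  show "continuous_on {0..} matern_5_2"
    unfolding matern_5_2_def by (intro continuous_intros)
  show "(matern_5_2 has_real_derivative ?D x) (at x)" if "0 < x" for x
  proof -
    \<comment> \<open>This collapses a pair of equal roots at the head of a right-nested
      product.\<close>
    have sqrt_mult_sqrt: "sqrt a * (sqrt a * z) = a * z" if "0 \<le> a" for a z
      using that by (simp flip: mult.assoc)
    show ?thesis
      unfolding matern_5_2_def using that
      by (auto intro!: derivative_eq_intros simp: field_simps sqrt_mult_sqrt)
  qed
  show "?D x \<le> ?D y" if "0 < x" "x \<le> y" for x y
    using one_plus_times_exp_minus_antimono[of "sqrt 5 * sqrt x" "sqrt 5 * sqrt y"] that by simp
qed

lemma convex_on_squared_exponential: "convex_on {0..} squared_exponential"
proof (rule convex_on_atLeastI)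
  show "continuous_on {0..} squared_exponential"
    unfolding squared_exponential_def by (intro continuous_intros)
  show "(squared_exponential has_real_derivative - (1 / 2 * exp (- (1 / 2 * x)))) (at x)" for x
    unfolding squared_exponential_def
    by (rule derivative_eq_intros refl)+ simp
qed simp

theorem mainTheorem1:
  fixes k :: "real \<Rightarrow> real"
  assumes "k \<in> {matern_1_2, matern_3_2, matern_5_2, squared_exponential}"
  shows "convex_on {0..} k \<and>
    (\<forall>dL dU. 0 \<le> dL \<and> dL < dU \<longrightarrow>
       is_convex_envelope {dL..dU} k k \<and>
       is_concave_envelope {dL..dU} k
         (\<lambda>d. (k dU - k dL) / (dU - dL) * d + (dU * k dL - dL * k dU) / (dU - dL)))"
proof -
  have conv: "convex_on {0..} k"
    using assms convex_on_matern_1_2 convex_on_matern_3_2 convex_on_matern_5_2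
      convex_on_squared_exponential by auto
  then have "convex_on {dL..dU} k" if "0 \<le> dL" for dL dU
    by (rule convex_on_subset) (use that in auto)
  with conv show ?thesis
    by (blast intro: is_convex_envelope_self is_concave_envelope_secant)
qed

end
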